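(* The weak maximizing property does not imply the weak minimizing property in general: there exist Banach spaces $X$ and $Y$ such that the pair $(X,Y)$ has the weak maximizing property but does not have the weak minimizing property.
   Context: For Banach spaces $X,Y$, $\mathcal{L}(X,Y)$ denotes the space of bounded linear operators from $X$ to $Y$, and $S_X$ the unit sphere of $X$. An operator $T\in\mathcal{L}(X,Y)$ attains its norm if $\|Tx\|=\|T\|$ for some $x\in S_X$; a maximizing sequence for $T$ is a sequence $(x_n)_n$ in $S_X$ with $\|Tx_n\|\to\|T\|$. The pair $(X,Y)$ has the weak maximizing property (WMP) if every $T\in\mathcal{L}(X,Y)$ that admits a non-weakly null maximizing sequence (i.e. one that does not converge weakly to $0$) attains its norm. The minimum modulus of $T\in\mathcal{L}(X,Y)$ is $m(T)=\inf\{\|Tx\|:x\in S_X\}$; $T$ attains its minimum modulus if $\|Tx\|=m(T)$ for some $x\in S_X$. A minimizing sequence for $T$ is a sequence $(x_n)_n$ in $S_X$ with $\|Tx_n\|\to m(T)$. The pair $(X,Y)$ has the weak minimizing property (WmP) if every $T\in\mathcal{L}(X,Y)$ that admits a non-weakly null minimizing sequence attains its minimum modulus. *)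

theory Defs
  imports "HOL-Analysis.Analysis" "HOL-Library.Function_Algebras"
begin

text \<open>
  Existence of a Banach space cannot be stated by quantifying over the type class \<open>banach\<close>.
  A normed space is therefore given by a linear subspace of an ambient real vector space together
  with a norm of its own; the ambient type contributes only the vector space operations.
\<close>

record 'a normed_space =
  pts :: "'a set"
  nrm :: "'a \<Rightarrow> real"

definition banach_space :: "'a::real_vector normed_space \<Rightarrow> bool" where
  "banach_space X \<longleftrightarrow>
     subspace (pts X) \<and>
     (\<forall>x\<in>pts X. 0 \<le> nrm X x) \<and>
     (\<forall>x\<in>pts X. nrm X x = 0 \<longleftrightarrow> x = 0) \<and>
     (\<forall>x\<in>pts X. \<forall>c. nrm X (c *\<^sub>R x) = \<bar>c\<bar> * nrm X x) \<and>
     (\<forall>x\<in>pts X. \<forall>y\<in>pts X. nrm X (x + y) \<le> nrm X x + nrm X y) \<and>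
     (\<forall>s::nat \<Rightarrow> 'a.
        (\<forall>n. s n \<in> pts X) \<and>
        (\<forall>e>0. \<exists>N. \<forall>m\<ge>N. \<forall>n\<ge>N. nrm X (s m - s n) < e) \<longrightarrow>
        (\<exists>l\<in>pts X. (\<lambda>n. nrm X (s n - l)) \<longlonglongrightarrow> 0))"

definition unit_sphere :: "'a normed_space \<Rightarrow> 'a set" where
  "unit_sphere X = {x \<in> pts X. nrm X x = 1}"

text \<open>An operator is a function on the ambient type; its values outside \<open>pts X\<close> are irrelevant.\<close>

definition bounded_operator ::
  "'a::real_vector normed_space \<Rightarrow> 'b::real_vector normed_space \<Rightarrow> ('a \<Rightarrow> 'b) \<Rightarrow> bool" where
  "bounded_operator X Y T \<longleftrightarrow>
     (\<forall>x\<in>pts X. T x \<in> pts Y) \<and>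
     (\<forall>x\<in>pts X. \<forall>y\<in>pts X. T (x + y) = T x + T y) \<and>
     (\<forall>x\<in>pts X. \<forall>c. T (c *\<^sub>R x) = c *\<^sub>R T x) \<and>
     (\<exists>C. \<forall>x\<in>pts X. nrm Y (T x) \<le> C * nrm X x)"

definition operator_norm :: "'a normed_space \<Rightarrow> 'b normed_space \<Rightarrow> ('a \<Rightarrow> 'b) \<Rightarrow> real" where
  "operator_norm X Y T = (SUP x\<in>{x \<in> pts X. nrm X x \<le> 1}. nrm Y (T x))"

definition min_modulus :: "'a normed_space \<Rightarrow> 'b normed_space \<Rightarrow> ('a \<Rightarrow> 'b) \<Rightarrow> real" where
  "min_modulus X Y T = (INF x\<in>unit_sphere X. nrm Y (T x))"

definition scalars :: "real normed_space" where
  "scalars = \<lparr>pts = UNIV, nrm = abs\<rparr>"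

definition weakly_null :: "'a::real_vector normed_space \<Rightarrow> (nat \<Rightarrow> 'a) \<Rightarrow> bool" where
  "weakly_null X s \<longleftrightarrow>
     (\<forall>f. bounded_operator X scalars f \<longrightarrow> (\<lambda>n. f (s n)) \<longlonglongrightarrow> 0)"

definition attains_norm :: "'a normed_space \<Rightarrow> 'b normed_space \<Rightarrow> ('a \<Rightarrow> 'b) \<Rightarrow> bool" where
  "attains_norm X Y T \<longleftrightarrow> (\<exists>x\<in>unit_sphere X. nrm Y (T x) = operator_norm X Y T)"

definition attains_min_modulus ::
  "'a normed_space \<Rightarrow> 'b normed_space \<Rightarrow> ('a \<Rightarrow> 'b) \<Rightarrow> bool" where
  "attains_min_modulus X Y T \<longleftrightarrow> (\<exists>x\<in>unit_sphere X. nrm Y (T x) = min_modulus X Y T)"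

definition maximizing_sequence ::
  "'a normed_space \<Rightarrow> 'b normed_space \<Rightarrow> ('a \<Rightarrow> 'b) \<Rightarrow> (nat \<Rightarrow> 'a) \<Rightarrow> bool" where
  "maximizing_sequence X Y T s \<longleftrightarrow>
     (\<forall>n. s n \<in> unit_sphere X) \<and> (\<lambda>n. nrm Y (T (s n))) \<longlonglongrightarrow> operator_norm X Y T"

definition minimizing_sequence ::
  "'a normed_space \<Rightarrow> 'b normed_space \<Rightarrow> ('a \<Rightarrow> 'b) \<Rightarrow> (nat \<Rightarrow> 'a) \<Rightarrow> bool" where
  "minimizing_sequence X Y T s \<longleftrightarrow>
     (\<forall>n. s n \<in> unit_sphere X) \<and> (\<lambda>n. nrm Y (T (s n))) \<longlonglongrightarrow> min_modulus X Y T"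

definition weak_maximizing_property ::
  "'a::real_vector normed_space \<Rightarrow> 'b::real_vector normed_space \<Rightarrow> bool" where
  "weak_maximizing_property X Y \<longleftrightarrow>
     (\<forall>T. bounded_operator X Y T \<longrightarrow>
        (\<exists>s. maximizing_sequence X Y T s \<and> \<not> weakly_null X s) \<longrightarrow> attains_norm X Y T)"

definition weak_minimizing_property ::
  "'a::real_vector normed_space \<Rightarrow> 'b::real_vector normed_space \<Rightarrow> bool" where
  "weak_minimizing_property X Y \<longleftrightarrow>
     (\<forall>T. bounded_operator X Y T \<longrightarrow>
        (\<exists>s. minimizing_sequence X Y T s \<and> \<not> weakly_null X s) \<longrightarrow> attains_min_modulus X Y T)"

text \<open>
  The real sequences with pointwise operations serve as the ambient vector space. Every separable
  real Banach space is isometrically isomorphic to a \<open>normed_space\<close> over it, via a norming sequence of functionals.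
\<close>

instantiation "fun" :: (type, real_vector) real_vector
begin

definition scaleR_fun :: "real \<Rightarrow> ('a \<Rightarrow> 'b) \<Rightarrow> 'a \<Rightarrow> 'b" where
  "scaleR_fun c f = (\<lambda>x. c *\<^sub>R f x)"

instance
  by standard (simp_all add: scaleR_fun_def fun_eq_iff scaleR_add_right scaleR_add_left)

end

end

(*
  X is l2, and Y is l2 with the equivalent norm max(|y_0|, |(y_1, y_2, ...)|).
  If y_n converges to 0 weakly in Y, then limsup |y + y_n|^2 <= |y|^2 + limsup |y_n|^2.  For a
  maximizing sequence with nonzero weak limit x (along a subsequence) of T with norm M this gives
  M^2 <= |T x|^2 + M^2 (1 - |x|^2), so T attains its norm at x / |x|.  There is no corresponding
  lower estimate in Y: the operator multiplying the k-th coordinate by 1 + 1/k (k >= 1) has minimum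
  modulus sqrt(1/2), approached along sqrt(1/2) (e_0 + e_n) but not attained.
*)

theory Submission
  imports Defs "HOL-Complex_Analysis.Great_Picard"
begin

section \<open>The space of square-summable sequences\<close>

text \<open>The norm of Y is the maximum of two Hilbertian pieces. Each piece obeys Pythagoras
  asymptotically under weakly null perturbations, and the maximum of two such sums is at most the
  sum of the maxima, which gives the upper estimate. The reverse fails when the maxima sit on
  different pieces: for y = c e_0 and y_n = c e_n with c >= 0, the norm of y + y_n is still c. A
  two-sided estimate would let the maximizing argument run backwards and yield the minimizing
  property too. On the unit sphere of l2 the norm of Y is smallest, namely sqrt(1/2), exactly where
  both pieces have equal size. Stretching the coordinates k >= 1 by factors above 1 that tend to 1
  destroys these minimizers without changing the infimum. Weak convergence is handled as bounded
  coordinatewise convergence. The Riesz representation links the two, both for the functional that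
  witnesses a non-weakly null sequence and for the coordinates of T.\<close>

definition ip :: "(nat \<Rightarrow> real) \<Rightarrow> (nat \<Rightarrow> real) \<Rightarrow> real" where
  "ip x y = (\<Sum>k. x k * y k)"

definition norm2 :: "(nat \<Rightarrow> real) \<Rightarrow> real" where
  "norm2 x = sqrt (ip x x)"

definition l2 :: "(nat \<Rightarrow> real) normed_space" where
  "l2 = \<lparr>pts = {x. summable (\<lambda>k. x k * x k)}, nrm = norm2\<rparr>"

lemma nrm_l2 [simp]: "nrm l2 = norm2"
  by (simp add: l2_def)

lemma l2_iff: "x \<in> pts l2 \<longleftrightarrow> summable (\<lambda>k. x k * x k)"
  by (simp add: l2_def)

lemma summable_mult_l2:
  assumes "x \<in> pts l2" "y \<in> pts l2"
  shows "summable (\<lambda>k. x k * y k)"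
proof (rule summable_comparison_test)
  have "\<bar>x k * y k\<bar> \<le> x k * x k + y k * y k" for k
  proof -
    have "0 \<le> (\<bar>x k\<bar> - \<bar>y k\<bar>)\<^sup>2" by simp
    then have "2 * (\<bar>x k\<bar> * \<bar>y k\<bar>) \<le> x k * x k + y k * y k"
      by (simp add: power2_eq_square algebra_simps)
    moreover have "0 \<le> \<bar>x k\<bar> * \<bar>y k\<bar>" by simp
    ultimately show ?thesis unfolding abs_mult by linarith
  qed
  then show "\<exists>N. \<forall>k\<ge>N. norm (x k * y k) \<le> x k * x k + y k * y k"
    by auto
  show "summable (\<lambda>k. x k * x k + y k * y k)"
    using assms by (simp add: l2_iff summable_add)
qed

lemma ip_commute: "ip x y = ip y x"
  by (simp add: ip_def mult.commute)

lemma add_l2: "x \<in> pts l2 \<Longrightarrow> y \<in> pts l2 \<Longrightarrow> x + y \<in> pts l2"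
proof -
  assume *: "x \<in> pts l2" "y \<in> pts l2"
  have "summable (\<lambda>k. x k * x k + 2 * (x k * y k) + y k * y k)"
    by (intro summable_add summable_mult summable_mult_l2 *)
  then show ?thesis
    by (simp add: l2_iff algebra_simps)
qed

lemma scaleR_l2: "x \<in> pts l2 \<Longrightarrow> c *\<^sub>R x \<in> pts l2"
proof -
  assume "x \<in> pts l2"
  then have "summable (\<lambda>k. c\<^sup>2 * (x k * x k))"
    by (intro summable_mult) (simp add: l2_iff)
  then show ?thesis
    by (simp add: l2_iff scaleR_fun_def power2_eq_square mult_ac)
qed

lemma zero_l2: "0 \<in> pts l2"
  by (simp add: l2_iff)

lemma subspace_l2: "subspace (pts l2)"
  by (simp add: subspace_def zero_l2 add_l2 scaleR_l2)

lemma diff_l2: "x \<in> pts l2 \<Longrightarrow> y \<in> pts l2 \<Longrightarrow> x - y \<in> pts l2"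
  by (rule subspace_diff[OF subspace_l2])

lemma ip_add_left:
  "x \<in> pts l2 \<Longrightarrow> y \<in> pts l2 \<Longrightarrow> z \<in> pts l2 \<Longrightarrow> ip (x + y) z = ip x z + ip y z"
  unfolding ip_def by (simp add: distrib_right suminf_add summable_mult_l2)

lemma ip_scaleR_left: "x \<in> pts l2 \<Longrightarrow> z \<in> pts l2 \<Longrightarrow> ip (c *\<^sub>R x) z = c * ip x z"
  unfolding ip_def by (simp add: scaleR_fun_def mult.assoc suminf_mult summable_mult_l2)

lemma ip_add_self:
  assumes x: "x \<in> pts l2" and y: "y \<in> pts l2"
  shows "ip (x + y) (x + y) = ip x x + 2 * ip x y + ip y y"
  using ip_add_left[OF x y add_l2[OF x y]] ip_add_left[OF x y x] ip_add_left[OF x y y]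
    ip_commute[of x "x + y"] ip_commute[of y "x + y"] ip_commute[of y x]
  by linarith

lemma ip_self_nonneg: "x \<in> pts l2 \<Longrightarrow> 0 \<le> ip x x"
  unfolding ip_def l2_iff by (rule suminf_nonneg) auto

lemma ip_self_eq_0_iff: "x \<in> pts l2 \<Longrightarrow> ip x x = 0 \<longleftrightarrow> x = 0"
  unfolding ip_def l2_iff by (subst suminf_eq_zero_iff) (auto simp: fun_eq_iff)

lemma norm2_nonneg: "x \<in> pts l2 \<Longrightarrow> 0 \<le> norm2 x"
  by (simp add: norm2_def ip_self_nonneg)

lemma norm2_power2: "x \<in> pts l2 \<Longrightarrow> (norm2 x)\<^sup>2 = ip x x"
  by (simp add: norm2_def ip_self_nonneg)

lemma norm2_scaleR: "x \<in> pts l2 \<Longrightarrow> norm2 (c *\<^sub>R x) = \<bar>c\<bar> * norm2 x"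
  by (simp add: norm2_def ip_scaleR_left scaleR_l2 ip_commute[of x "c *\<^sub>R x"]
      real_sqrt_mult flip: mult.assoc)

lemma ip_Cauchy_Schwarz:
  assumes x: "x \<in> pts l2" and y: "y \<in> pts l2"
  shows "\<bar>ip x y\<bar> \<le> norm2 x * norm2 y"
proof (cases "y = 0")
  case True
  then show ?thesis
    by (simp add: ip_def norm2_def)
next
  case False
  define b where "b = ip x y"
  define c where "c = ip y y"
  have c: "c > 0"
    using False ip_self_nonneg[OF y] ip_self_eq_0_iff[OF y] by (simp add: c_def)
  \<comment> \<open>The factor \<open>- b / c\<close> minimizes the quadratic polynomial in
    \<open>t\<close> given by the squared norm of \<open>x + t y\<close>.\<close>
  have "0 \<le> ip (x + (- b / c) *\<^sub>R y) (x + (- b / c) *\<^sub>R y)"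
    by (intro ip_self_nonneg add_l2 scaleR_l2 x y)
  also have "\<dots> = ip x x + 2 * (- b / c * b) + (- b / c) * ((- b / c) * c)"
    unfolding b_def c_def ip_add_self[OF x scaleR_l2[OF y]] ip_commute[of x "_ *\<^sub>R _"]
      ip_scaleR_left[OF y x] ip_scaleR_left[OF y scaleR_l2[OF y]] ip_commute[of y "_ *\<^sub>R _"]
      ip_scaleR_left[OF y y] ip_commute[of y x] ..
  also have "\<dots> = ip x x - b\<^sup>2 / c"
    using c by (simp add: field_simps power2_eq_square)
  finally have "b\<^sup>2 \<le> ip x x * c"
    using c by (simp add: field_simps)
  then have "sqrt (b\<^sup>2) \<le> sqrt (ip x x * c)"
    by (rule real_sqrt_le_mono)
  then show ?thesis
    by (simp add: b_def c_def norm2_def real_sqrt_mult)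
qed

lemma norm2_triangle:
  assumes x: "x \<in> pts l2" and y: "y \<in> pts l2"
  shows "norm2 (x + y) \<le> norm2 x + norm2 y"
proof (rule power2_le_imp_le)
  have "(norm2 (x + y))\<^sup>2 = (norm2 x)\<^sup>2 + 2 * ip x y + (norm2 y)\<^sup>2"
    using x y by (simp add: norm2_power2 add_l2 ip_add_self)
  also have "\<dots> \<le> (norm2 x)\<^sup>2 + 2 * (norm2 x * norm2 y) + (norm2 y)\<^sup>2"
    using ip_Cauchy_Schwarz[OF x y] by simp
  finally show "(norm2 (x + y))\<^sup>2 \<le> (norm2 x + norm2 y)\<^sup>2"
    by (simp add: power2_eq_square algebra_simps)
qed (simp add: norm2_nonneg x y)

lemma l2_partial_sums_le:
  assumes "\<And>N. (\<Sum>k<N. x k * x k) \<le> B\<^sup>2" "0 \<le> B"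
  shows "x \<in> pts l2" "norm2 x \<le> B"
proof -
  show x: "x \<in> pts l2"
    unfolding l2_iff by (rule summableI_nonneg_bounded[OF _ assms(1)]) auto
  have "ip x x \<le> B\<^sup>2"
    unfolding ip_def using x assms(1) by (intro suminf_le_const) (auto simp: l2_iff)
  then have "sqrt (ip x x) \<le> sqrt (B\<^sup>2)"
    by (rule real_sqrt_le_mono)
  then show "norm2 x \<le> B"
    using assms(2) by (simp add: norm2_def)
qed

lemma partial_sums_le_norm2:
  assumes "x \<in> pts l2"
  shows "(\<Sum>k<N. x k * x k) \<le> (norm2 x)\<^sup>2"
  using assms unfolding norm2_power2[OF assms] ip_def l2_iff by (intro sum_le_suminf) auto

lemma abs_nth_le_norm2:
  assumes "x \<in> pts l2"
  shows "\<bar>x k\<bar> \<le> norm2 x"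
proof -
  have "x k * x k \<le> (\<Sum>k<Suc k. x k * x k)"
    by (simp add: sum_nonneg)
  also have "\<dots> \<le> (norm2 x)\<^sup>2"
    by (rule partial_sums_le_norm2[OF assms])
  finally have "\<bar>x k\<bar>\<^sup>2 \<le> (norm2 x)\<^sup>2"
    by (simp add: power2_eq_square)
  then show ?thesis
    using norm2_nonneg[OF assms] by (rule power2_le_imp_le)
qed

text \<open>A Fatou argument: a sum over finitely many coordinates passes to the limit, and the
  bound \<open>B\<close> does not depend on how many there are. The norm bound is only required
  eventually because in a Cauchy sequence it holds from some index on.\<close>

lemma l2_bounded_pointwise_limit:
  assumes "\<And>n. u n \<in> pts l2" "\<forall>\<^sub>F n in sequentially. norm2 (u n) \<le> B" "0 \<le> B"
    and "\<And>k. (\<lambda>n. u n k) \<longlonglongrightarrow> x k"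
  shows "x \<in> pts l2" "norm2 x \<le> B"
proof -
  have "(\<Sum>k<N. x k * x k) \<le> B\<^sup>2" for N
  proof (rule tendsto_upperbound)
    show "(\<lambda>n. \<Sum>k<N. u n k * u n k) \<longlonglongrightarrow> (\<Sum>k<N. x k * x k)"
      by (intro tendsto_intros assms)
    show "\<forall>\<^sub>F n in sequentially. (\<Sum>k<N. u n k * u n k) \<le> B\<^sup>2"
      using assms(2)
    proof eventually_elim
      case (elim n)
      have "(\<Sum>k<N. u n k * u n k) \<le> (norm2 (u n))\<^sup>2"
        by (rule partial_sums_le_norm2[OF assms(1)])
      also have "\<dots> \<le> B\<^sup>2"
        using elim norm2_nonneg[OF assms(1)] by (rule power_mono)
      finally show ?case .
    qed
  qed simp
  then show "x \<in> pts l2" "norm2 x \<le> B"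
    using l2_partial_sums_le[OF _ assms(3)] by blast+
qed

lemma complete_l2:
  assumes s: "\<And>n. s n \<in> pts l2"
    and Cau: "\<And>e. e > 0 \<Longrightarrow> \<exists>N. \<forall>m\<ge>N. \<forall>n\<ge>N. norm2 (s m - s n) < e"
  shows "\<exists>l\<in>pts l2. (\<lambda>n. norm2 (s n - l)) \<longlonglongrightarrow> 0"
proof -
  have "Cauchy (\<lambda>n. s n k)" for k
  proof (rule metric_CauchyI)
    fix e :: real assume "e > 0"
    then obtain N where N: "\<forall>m\<ge>N. \<forall>n\<ge>N. norm2 (s m - s n) < e"
      using Cau by blast
    have "dist (s m k) (s n k) \<le> norm2 (s m - s n)" for m n
      using abs_nth_le_norm2[OF diff_l2[OF s[of m] s[of n]], of k] by (simp add: dist_real_def)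
    with N show "\<exists>M. \<forall>m\<ge>M. \<forall>n\<ge>M. dist (s m k) (s n k) < e"
      by (meson le_less_trans)
  qed
  then obtain l where l: "\<And>k. (\<lambda>n. s n k) \<longlonglongrightarrow> l k"
    using that[of "\<lambda>k. lim (\<lambda>n. s n k)"]
    unfolding Cauchy_convergent_iff convergent_LIMSEQ_iff by blast
  \<comment> \<open>Fix \<open>m\<close> and let \<open>n\<close> tend to infinity in
    \<open>s m - s n\<close>: the Cauchy bound survives the coordinatewise limit, weakened from
    \<open><\<close> to \<open>\<le>\<close>.\<close>
  have close: "\<exists>N. \<forall>n\<ge>N. s n - l \<in> pts l2 \<and> norm2 (s n - l) \<le> e" if e: "e > 0" for e
  proof -
    obtain N where N: "\<forall>m\<ge>N. \<forall>n\<ge>N. norm2 (s m - s n) < e"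
      using Cau[OF e] by blast
    have "s m - l \<in> pts l2 \<and> norm2 (s m - l) \<le> e" if m: "m \<ge> N" for m
    proof -
      have ev: "\<forall>\<^sub>F n in sequentially. norm2 (s m - s n) \<le> e"
        unfolding eventually_sequentially using N m less_imp_le by blast
      have lim: "(\<lambda>n. (s m - s n) k) \<longlonglongrightarrow> (s m - l) k" for k
        by (auto intro!: tendsto_intros l)
      show ?thesis
        using l2_bounded_pointwise_limit[OF diff_l2[OF s s] ev less_imp_le[OF \<open>e > 0\<close>] lim]
        by blast
    qed
    then show ?thesis by blast
  qed
  \<comment> \<open>One index at which the difference is square-summable puts the limit itself into
    the space.\<close>
  obtain n where "s n - l \<in> pts l2"
    using close[of 1] by auto
  then have "s n - (s n - l) \<in> pts l2"
    by (rule diff_l2[OF s])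
  then have "l \<in> pts l2"
    by simp
  moreover have "(\<lambda>n. norm2 (s n - l)) \<longlonglongrightarrow> 0"
  proof (rule LIMSEQ_I)
    fix e :: real assume "e > 0"
    then obtain N where "\<forall>n\<ge>N. s n - l \<in> pts l2 \<and> norm2 (s n - l) \<le> e / 2"
      using close[of "e / 2"] by auto
    then show "\<exists>N. \<forall>n\<ge>N. norm (norm2 (s n - l) - 0) < e"
      using \<open>e > 0\<close> by (intro exI[of _ N]) (force simp: norm2_nonneg)
  qed
  ultimately show ?thesis by blast
qed

lemma banach_l2: "banach_space l2"
  unfolding banach_space_def
  using subspace_l2 norm2_nonneg norm2_scaleR norm2_triangle
  by (auto intro: complete_l2) (auto simp: norm2_def ip_self_eq_0_iff)

text \<open>By \<open>lower\<close> a Cauchy sequence for the norm of \<open>Y\<close> is Cauchy for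
  that of \<open>X\<close>, and by \<open>upper\<close> its limit in \<open>X\<close> is also a
  limit in \<open>Y\<close>.\<close>

lemma banach_space_equivalent_norm:
  assumes X: "banach_space X" and "pts Y = pts X"
    and zero: "\<And>x. x \<in> pts X \<Longrightarrow> nrm Y x = 0 \<longleftrightarrow> x = 0"
    and scale: "\<And>x c. x \<in> pts X \<Longrightarrow> nrm Y (c *\<^sub>R x) = \<bar>c\<bar> * nrm Y x"
    and triangle: "\<And>x y. x \<in> pts X \<Longrightarrow> y \<in> pts X \<Longrightarrow> nrm Y (x + y) \<le> nrm Y x + nrm Y y"
    and nonneg: "\<And>x. x \<in> pts X \<Longrightarrow> 0 \<le> nrm Y x"
    and upper: "\<And>x. x \<in> pts X \<Longrightarrow> nrm Y x \<le> nrm X x"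
    and lower: "\<And>x. x \<in> pts X \<Longrightarrow> nrm X x \<le> C * nrm Y x" and C: "C > 0"
  shows "banach_space Y"
proof -
  have sub: "subspace (pts X)"
    and complete: "\<forall>s::nat \<Rightarrow> 'a.
        (\<forall>n. s n \<in> pts X) \<and>
        (\<forall>e>0. \<exists>N. \<forall>m\<ge>N. \<forall>n\<ge>N. nrm X (s m - s n) < e) \<longrightarrow>
        (\<exists>l\<in>pts X. (\<lambda>n. nrm X (s n - l)) \<longlonglongrightarrow> 0)"
    using X by (simp_all add: banach_space_def)
  have "\<exists>l\<in>pts X. (\<lambda>n. nrm Y (s n - l)) \<longlonglongrightarrow> 0"
    if s: "\<And>n. s n \<in> pts X"
      and Cau: "\<And>e. e > 0 \<Longrightarrow> \<exists>N. \<forall>m\<ge>N. \<forall>n\<ge>N. nrm Y (s m - s n) < e" for s :: "nat \<Rightarrow> 'a"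
  proof -
    have "\<exists>N. \<forall>m\<ge>N. \<forall>n\<ge>N. nrm X (s m - s n) < e" if e: "e > 0" for e
    proof -
      obtain N where N: "\<forall>m\<ge>N. \<forall>n\<ge>N. nrm Y (s m - s n) < e / C"
        using Cau[OF divide_pos_pos[OF e C]] by blast
      have "nrm X (s m - s n) < e" if "m \<ge> N" "n \<ge> N" for m n
      proof -
        have "nrm X (s m - s n) \<le> C * nrm Y (s m - s n)"
          by (intro lower subspace_diff[OF sub] s)
        also have "\<dots> < C * (e / C)"
          using N that C by (intro mult_strict_left_mono) auto
        finally show ?thesis using C by simp
      qed
      then show ?thesis by blast
    qed
    then have "\<exists>l\<in>pts X. (\<lambda>n. nrm X (s n - l)) \<longlonglongrightarrow> 0"
      using complete[rule_format, of s] s by simp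
    then obtain l where l: "l \<in> pts X" "(\<lambda>n. nrm X (s n - l)) \<longlonglongrightarrow> 0"
      by blast
    have "(\<lambda>n. nrm Y (s n - l)) \<longlonglongrightarrow> 0"
      by (rule tendsto_sandwich[OF _ _ tendsto_const l(2)])
        (intro always_eventually allI nonneg upper subspace_diff[OF sub] s l)+
    with l(1) show ?thesis by blast
  qed
  then show ?thesis
    unfolding banach_space_def \<open>pts Y = pts X\<close>
    using sub zero scale triangle nonneg by blast
qed

section \<open>Bounded operators on the space of square-summable sequences\<close>

lemma bounded_operator_diff:
  assumes T: "bounded_operator X Y T" and X: "subspace (pts X)" and x: "x \<in> pts X" "y \<in> pts X"
  shows "T (x - y) = T x - T y"
proof -
  have "T (x + (-1) *\<^sub>R y) = T x + (-1) *\<^sub>R T y"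
    using T x subspace_scale[OF X] unfolding bounded_operator_def by metis
  then show ?thesis by simp
qed

text \<open>Split the series at an index \<open>N\<close> beyond which \<open>y\<close> has small
  norm. The far part is small uniformly in \<open>n\<close> by Cauchy-Schwarz and the bound
  \<open>B\<close>; the near part is a finite sum of null sequences.\<close>

lemma ip_tendsto_0:
  assumes y: "y \<in> pts l2" and v: "\<And>n. v n \<in> pts l2" and B: "\<And>n. norm2 (v n) \<le> B"
    and lim: "\<And>k. (\<lambda>n. v n k) \<longlonglongrightarrow> 0"
  shows "(\<lambda>n. ip y (v n)) \<longlonglongrightarrow> 0"
proof (rule LIMSEQ_I)
  fix e :: real assume e: "e > 0"
  have B0: "B \<ge> 0"
    using norm2_nonneg[OF v[of 0]] B[of 0] by linarith
  \<comment> \<open>Chosen so that \<open>d * B < e / 2\<close>; the summand 1 keeps the denominator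
    positive when \<open>B\<close> is 0.\<close>
  define d where "d = e / (2 * (B + 1))"
  have d: "d > 0"
    using e B0 by (simp add: d_def)
  have "d\<^sup>2 > 0" using d by simp
  then obtain N where "\<forall>n\<ge>N. norm (\<Sum>i. y (i + n) * y (i + n)) < d\<^sup>2"
    using suminf_exist_split[of "d\<^sup>2" "\<lambda>k. y k * y k"] y unfolding l2_iff by blast
  then have "\<bar>\<Sum>i. y (i + N) * y (i + N)\<bar> < d\<^sup>2"
    by simp
  then have "sqrt (\<Sum>i. y (i + N) * y (i + N)) \<le> sqrt (d\<^sup>2)"
    by (intro real_sqrt_le_mono) linarith
  then have yN: "norm2 (\<lambda>k. y (k + N)) \<le> d"
    using d by (simp add: norm2_def ip_def)
  have shift: "(\<lambda>k. x (k + N)) \<in> pts l2" if "x \<in> pts l2" for x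
    using that summable_ignore_initial_segment[of "\<lambda>k. x k * x k" N] by (simp add: l2_iff)
  have "(\<lambda>n. \<Sum>k<N. y k * v n k) \<longlonglongrightarrow> (\<Sum>k<N. y k * 0)"
    by (intro tendsto_intros lim)
  then have "(\<lambda>n. \<Sum>k<N. y k * v n k) \<longlonglongrightarrow> 0"
    by simp
  then obtain M where M: "\<forall>n\<ge>M. \<bar>\<Sum>k<N. y k * v n k\<bar> < e / 2"
    using LIMSEQ_D[of _ 0 "e / 2"] e by fastforce
  have "\<bar>ip y (v n)\<bar> < e" if "n \<ge> M" for n
  proof -
    have "ip y (v n) = ip (\<lambda>k. y (k + N)) (\<lambda>k. v n (k + N)) + (\<Sum>k<N. y k * v n k)"
      unfolding ip_def by (rule suminf_split_initial_segment[OF summable_mult_l2[OF y v]])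
    moreover have "\<bar>ip (\<lambda>k. y (k + N)) (\<lambda>k. v n (k + N))\<bar> \<le> d * B"
    proof -
      have "(\<Sum>k<K. v n (k + N) * v n (k + N)) \<le> B\<^sup>2" for K
      proof -
        have "(\<Sum>k<K. v n (k + N) * v n (k + N)) = (\<Sum>k\<in>{N..<K + N}. v n k * v n k)"
          using sum.shift_bounds_nat_ivl[of "\<lambda>k. v n k * v n k" 0 N K]
          by (simp add: lessThan_atLeast0)
        also have "\<dots> \<le> (\<Sum>k<K + N. v n k * v n k)"
          by (rule sum_mono2) auto
        also have "\<dots> \<le> (norm2 (v n))\<^sup>2"
          by (rule partial_sums_le_norm2[OF v])
        also have "\<dots> \<le> B\<^sup>2"
          by (rule power_mono[OF B norm2_nonneg[OF v]])
        finally show ?thesis .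
      qed
      then have "norm2 (\<lambda>k. v n (k + N)) \<le> B"
        by (rule l2_partial_sums_le(2)[OF _ B0])
      then have "norm2 (\<lambda>k. y (k + N)) * norm2 (\<lambda>k. v n (k + N)) \<le> d * B"
        using yN d by (intro mult_mono) (auto intro: norm2_nonneg shift v)
      then show ?thesis
        using ip_Cauchy_Schwarz[OF shift[OF y] shift[OF v[of n]]] by linarith
    qed
    moreover have "d * B < e / 2"
      using e B0 by (simp add: d_def field_simps)
    ultimately show ?thesis
      using M[rule_format, OF that] by linarith
  qed
  then show "\<exists>M. \<forall>n\<ge>M. norm (ip y (v n) - 0) < e"
    by auto
qed

text \<open>The representing sequence must list the values of \<open>f\<close> on the unit vectors.
  Linearity gives the formula on truncations, boundedness makes this sequence square-summable, and
  continuity extends the formula to all of the space.\<close>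

lemma l2_Riesz:
  assumes f: "bounded_operator l2 scalars f"
  obtains a where "a \<in> pts l2" "\<And>x. x \<in> pts l2 \<Longrightarrow> f x = ip a x"
proof -
  define \<delta> :: "nat \<Rightarrow> nat \<Rightarrow> real" where "\<delta> k = (\<lambda>i. if i = k then 1 else 0)" for k
  define a where "a k = f (\<delta> k)" for k
  define tr :: "nat \<Rightarrow> (nat \<Rightarrow> real) \<Rightarrow> nat \<Rightarrow> real"
    where "tr N x = (\<lambda>k. if k < N then x k else 0)" for N x
  obtain C0 where C0: "\<And>x. x \<in> pts l2 \<Longrightarrow> \<bar>f x\<bar> \<le> C0 * norm2 x"
    using f unfolding bounded_operator_def scalars_def by (simp, blast)
  \<comment> \<open>The absolute value makes the bound visibly nonnegative, as
    \<open>l2_partial_sums_le\<close> requires.\<close>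
  define C where "C = \<bar>C0\<bar>"
  have C: "\<bar>f x\<bar> \<le> C * norm2 x" if "x \<in> pts l2" for x
    using C0[OF that] mult_right_mono[OF abs_ge_self[of C0] norm2_nonneg[OF that]]
    by (simp add: C_def)
  have add: "f (x + y) = f x + f y" if "x \<in> pts l2" "y \<in> pts l2" for x y
    using f that by (simp add: bounded_operator_def)
  have scale: "f (c *\<^sub>R x) = c * f x" if "x \<in> pts l2" for x c
    using f that by (simp add: bounded_operator_def)
  have tr_sums: "(\<lambda>k. tr N x k * tr N x k) sums (\<Sum>k<N. x k * x k)" for N x
    using sums_If_finite_set[of "{..<N}" "\<lambda>k. x k * x k"]
    by (simp add: tr_def if_distrib cong: if_cong)
  have tr: "tr N x \<in> pts l2" and norm_tr: "norm2 (tr N x) = sqrt (\<Sum>k<N. x k * x k)" for N x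
    using tr_sums[of N x] by (auto simp: l2_iff sums_iff norm2_def ip_def)
  have \<delta>: "\<delta> k \<in> pts l2" for k
  proof -
    have "\<delta> k = tr (Suc k) (\<delta> k)"
      by (auto simp: \<delta>_def tr_def)
    then show ?thesis by (metis tr)
  qed
  have f_tr: "f (tr N x) = (\<Sum>k<N. a k * x k)" for N x
  proof (induction N)
    case 0
    have "f (0 *\<^sub>R \<delta> 0) = 0"
      by (subst scale[OF \<delta>]) simp
    then show ?case
      by (simp add: tr_def zero_fun_def)
  next
    case (Suc N)
    have "tr (Suc N) x = tr N x + x N *\<^sub>R \<delta> N"
      by (auto simp: tr_def \<delta>_def scaleR_fun_def fun_eq_iff less_Suc_eq)
    then have "f (tr (Suc N) x) = f (tr N x) + x N * f (\<delta> N)"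
      by (simp add: add tr scaleR_l2 \<delta> scale)
    with Suc show ?case
      by (simp add: a_def)
  qed
  have a: "a \<in> pts l2"
  proof (rule l2_partial_sums_le(1))
    fix N
    define S where "S = (\<Sum>k<N. a k * a k)"
    have S: "S \<ge> 0"
      by (simp add: S_def sum_nonneg)
    \<comment> \<open>The functional is tested on the truncation of \<open>a\<close> itself, where
      its value is \<open>S\<close> and the norm is \<open>sqrt S\<close>. Dividing by
      \<open>sqrt S\<close> leaves a bound independent of \<open>N\<close>.\<close>
    have "S \<le> C * sqrt S"
      using C[OF tr, of N a] by (simp add: f_tr norm_tr S_def)
    then have "sqrt S * sqrt S \<le> C * sqrt S"
      using S by simp
    then have "sqrt S \<le> C"
    proof (cases "S = 0")
      case False
      then have "0 < sqrt S"
        using S by simp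
      then show ?thesis
        using \<open>sqrt S * sqrt S \<le> C * sqrt S\<close> by (rule mult_right_le_imp_le[rotated])
    qed (simp add: C_def)
    then have "(sqrt S)\<^sup>2 \<le> C\<^sup>2"
      using S by (intro power_mono) auto
    then show "S \<le> C\<^sup>2"
      using S by simp
  qed (simp add: C_def)
  have "f x = ip a x" if x: "x \<in> pts l2" for x
  proof -
    \<comment> \<open>The truncation and the remainder have disjoint supports, so squares subtract
      term by term and the remainder is controlled by the tail of a convergent series.\<close>
    have norm_rest: "norm2 (x - tr N x) = sqrt (ip x x - (\<Sum>k<N. x k * x k))" for N
    proof -
      have "(\<lambda>k. x k * x k - tr N x k * tr N x k) sums (ip x x - (\<Sum>k<N. x k * x k))"
        using x by (intro sums_diff tr_sums) (auto simp: l2_iff ip_def)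
      moreover have "(\<lambda>k. x k * x k - tr N x k * tr N x k) =
          (\<lambda>k. (x - tr N x) k * (x - tr N x) k)"
        by (auto simp: tr_def)
      ultimately show ?thesis
        by (simp add: norm2_def ip_def sums_iff)
    qed
    have "(\<lambda>N. \<Sum>k<N. x k * x k) \<longlonglongrightarrow> ip x x"
      using x unfolding l2_iff ip_def by (rule summable_LIMSEQ)
    then have "(\<lambda>N. C * sqrt (ip x x - (\<Sum>k<N. x k * x k))) \<longlonglongrightarrow> C * sqrt (ip x x - ip x x)"
      by (intro tendsto_intros)
    then have lim: "(\<lambda>N. C * sqrt (ip x x - (\<Sum>k<N. x k * x k))) \<longlonglongrightarrow> 0"
      by simp
    have "(\<lambda>N. f x - f (tr N x)) \<longlonglongrightarrow> 0"
    proof (rule Lim_null_comparison[OF always_eventually lim], rule allI)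
      fix N
      have "\<bar>f (x - tr N x)\<bar> \<le> C * norm2 (x - tr N x)"
        by (intro C diff_l2 x tr)
      then show "norm (f x - f (tr N x)) \<le> C * sqrt (ip x x - (\<Sum>k<N. x k * x k))"
        by (simp add: norm_rest bounded_operator_diff[OF f subspace_l2 x tr])
    qed
    then have "(\<lambda>N. f x - (f x - f (tr N x))) \<longlonglongrightarrow> f x - 0"
      by (intro tendsto_intros)
    then have "(\<lambda>N. \<Sum>k<N. a k * x k) \<longlonglongrightarrow> f x"
      by (simp add: f_tr)
    moreover have "(\<lambda>N. \<Sum>k<N. a k * x k) \<longlonglongrightarrow> ip a x"
      unfolding ip_def by (rule summable_LIMSEQ[OF summable_mult_l2[OF a x]])
    ultimately show ?thesis
      by (rule LIMSEQ_unique)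
  qed
  with a that show thesis by blast
qed

lemma functional_tendsto_0:
  assumes "bounded_operator l2 scalars f" "\<And>n. v n \<in> pts l2" "\<And>n. norm2 (v n) \<le> B"
    "\<And>k. (\<lambda>n. v n k) \<longlonglongrightarrow> 0"
  shows "(\<lambda>n. f (v n)) \<longlonglongrightarrow> 0"
proof -
  obtain a where "a \<in> pts l2" "\<And>x. x \<in> pts l2 \<Longrightarrow> f x = ip a x"
    using l2_Riesz[OF assms(1)] by blast
  then show ?thesis
    using ip_tendsto_0[of a v B] assms by simp
qed

lemma norm2_diff_le:
  assumes "x \<in> pts l2" "y \<in> pts l2"
  shows "norm2 (x - y) \<le> norm2 x + norm2 y"
  using norm2_triangle[OF assms(1) scaleR_l2[OF assms(2), of "-1"]] norm2_scaleR[OF assms(2), of "-1"]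
  by simp

text \<open>Weak sequential compactness of balls in coordinate form: coordinates are uniformly
  bounded, so the diagonal argument behind \<open>function_convergent_subsequence\<close> applies
  over the countable index set, and the Fatou argument keeps the limit in the space.\<close>

lemma l2_bounded_subsequence:
  fixes s :: "nat \<Rightarrow> nat \<Rightarrow> real"
  assumes "\<And>n. s n \<in> pts l2" "\<And>n. norm2 (s n) \<le> B"
  obtains r x where "strict_mono r" "x \<in> pts l2" "\<And>k. (\<lambda>n. s (r n) k) \<longlonglongrightarrow> x k"
proof -
  have "norm (s n k) \<le> B" for n k
    using abs_nth_le_norm2[OF assms(1), of n k] assms(2)[of n] by simp
  then obtain r :: "nat \<Rightarrow> nat"
    where r: "strict_mono r" "\<And>k. \<exists>l. (\<lambda>n. s (r n) k) \<longlonglongrightarrow> l"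
    using function_convergent_subsequence[of UNIV s B] by (metis UNIV_I countableI_type)
  obtain x where x: "\<And>k. (\<lambda>n. s (r n) k) \<longlonglongrightarrow> x k"
    using r(2) that[of "\<lambda>k. lim (\<lambda>n. s (r n) k)"]
    unfolding convergent_def[symmetric] convergent_LIMSEQ_iff by blast
  have "0 \<le> B"
    using norm2_nonneg[OF assms(1)] assms(2) order_trans by blast
  then have "x \<in> pts l2"
    using l2_bounded_pointwise_limit(1)[of "\<lambda>n. s (r n)" B x] assms x by simp
  with r x that show thesis by blast
qed

lemma operator_norm_bound:
  assumes X: "banach_space X" and Y: "banach_space Y" and T: "bounded_operator X Y T"
    and x: "x \<in> pts X"
  shows "nrm Y (T x) \<le> operator_norm X Y T * nrm X x"
proof -
  have scale: "nrm X (c *\<^sub>R z) = \<bar>c\<bar> * nrm X z" "c *\<^sub>R z \<in> pts X"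
    "nrm Y (T (c *\<^sub>R z)) = \<bar>c\<bar> * nrm Y (T z)" if "z \<in> pts X" for c z
    using X Y T that by (auto simp: banach_space_def bounded_operator_def subspace_scale)
  have nonneg: "0 \<le> nrm X z" if "z \<in> pts X" for z
    using X that by (simp add: banach_space_def)
  obtain C where C: "\<And>z. z \<in> pts X \<Longrightarrow> nrm Y (T z) \<le> C * nrm X z"
    using T unfolding bounded_operator_def by blast
  have "nrm Y (T z) \<le> \<bar>C\<bar>" if "z \<in> pts X" "nrm X z \<le> 1" for z
  proof -
    have "C * nrm X z \<le> \<bar>C\<bar> * 1"
      using that nonneg[OF that(1)] by (intro mult_mono) auto
    then show ?thesis
      using C[OF that(1)] by simp
  qed
  \<comment> \<open>The supremum in \<open>operator_norm\<close> dominates its members only once the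
    set is known to be bounded above.\<close>
  then have bdd: "bdd_above ((\<lambda>z. nrm Y (T z)) ` {z \<in> pts X. nrm X z \<le> 1})"
    by (intro bdd_aboveI[of _ "\<bar>C\<bar>"]) auto
  show ?thesis
  proof (cases "nrm X x = 0")
    case True
    then show ?thesis
      using C[OF x] by simp
  next
    case False
    then have pos: "nrm X x > 0"
      using nonneg[OF x] by simp
    have "nrm Y (T (inverse (nrm X x) *\<^sub>R x)) \<le> operator_norm X Y T"
      unfolding operator_norm_def using pos scale[OF x]
      by (intro cSUP_upper bdd) auto
    then show ?thesis
      using pos by (simp add: scale[OF x] field_simps)
  qed
qed

section \<open>The renormed target space\<close>

definition tail :: "(nat \<Rightarrow> real) \<Rightarrow> nat \<Rightarrow> real" where
  "tail x = (\<lambda>k. x (Suc k))"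

text \<open>This is the l-infinity sum of the real line and \<open>l2\<close>. Keeping the points of
  \<open>l2\<close> lets the coordinate arguments and the completeness proof carry over.\<close>

definition max_l2 :: "(nat \<Rightarrow> real) normed_space" where
  "max_l2 = \<lparr>pts = pts l2, nrm = \<lambda>x. max \<bar>x 0\<bar> (norm2 (tail x))\<rparr>"

lemma pts_max_l2 [simp]: "pts max_l2 = pts l2"
  by (simp add: max_l2_def)

lemma nrm_max_l2: "nrm max_l2 x = max \<bar>x 0\<bar> (norm2 (tail x))"
  by (simp add: max_l2_def)

lemma tail_l2_iff: "tail x \<in> pts l2 \<longleftrightarrow> x \<in> pts l2"
  using summable_Suc_iff[of "\<lambda>k. x k * x k"] by (simp add: l2_iff tail_def)

lemma tail_add: "tail (x + y) = tail x + tail y"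
  by (auto simp: tail_def)

lemma tail_scaleR: "tail (c *\<^sub>R x) = c *\<^sub>R tail x"
  by (auto simp: tail_def scaleR_fun_def)

lemma norm2_split_head:
  assumes "x \<in> pts l2"
  shows "(norm2 x)\<^sup>2 = (x 0)\<^sup>2 + (norm2 (tail x))\<^sup>2"
  using suminf_split_head[of "\<lambda>k. x k * x k"] assms
  by (simp add: norm2_power2 tail_l2_iff) (simp add: ip_def tail_def l2_iff power2_eq_square)

lemma nrm_max_l2_le:
  assumes x: "x \<in> pts l2"
  shows "nrm max_l2 x \<le> norm2 x"
proof -
  have "(norm2 (tail x))\<^sup>2 \<le> (norm2 x)\<^sup>2"
    by (simp add: norm2_split_head[OF x])
  then have "norm2 (tail x) \<le> norm2 x"
    using norm2_nonneg[OF x] by (rule power2_le_imp_le)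
  then show ?thesis
    by (simp add: nrm_max_l2 abs_nth_le_norm2[OF x])
qed

text \<open>The factor 2 comes from bounding the Euclidean combination of the two pieces by their
  sum, and the sum by twice the maximum.\<close>

lemma norm2_le_nrm_max_l2:
  assumes x: "x \<in> pts l2"
  shows "norm2 x \<le> 2 * nrm max_l2 x"
proof -
  have "0 \<le> norm2 (tail x)"
    using x by (simp add: norm2_nonneg tail_l2_iff)
  have "norm2 x \<le> \<bar>x 0\<bar> + norm2 (tail x)"
    by (rule power2_le_imp_le) (use \<open>0 \<le> norm2 (tail x)\<close> in \<open>auto simp: norm2_split_head[OF x] power2_sum\<close>)
  with \<open>0 \<le> norm2 (tail x)\<close> show ?thesis
    unfolding nrm_max_l2 by linarith
qed

lemma abs_nth_le_nrm_max_l2: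
  assumes "x \<in> pts l2"
  shows "\<bar>x k\<bar> \<le> nrm max_l2 x"
proof (cases k)
  case (Suc j)
  have "\<bar>tail x j\<bar> \<le> norm2 (tail x)"
    using assms by (intro abs_nth_le_norm2) (simp add: tail_l2_iff)
  then show ?thesis
    by (simp add: Suc nrm_max_l2 tail_def)
qed (simp add: nrm_max_l2)

lemma banach_max_l2: "banach_space max_l2"
proof (rule banach_space_equivalent_norm[OF banach_l2, where C = 2])
  fix x y :: "nat \<Rightarrow> real" and c
  assume x: "x \<in> pts l2"
  show nonneg: "0 \<le> nrm max_l2 x"
    by (simp add: nrm_max_l2 le_max_iff_disj)
  show le: "nrm max_l2 x \<le> nrm l2 x" and ge: "nrm l2 x \<le> 2 * nrm max_l2 x"
    using x by (simp_all add: nrm_max_l2_le norm2_le_nrm_max_l2)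
  have "norm2 x = 0 \<longleftrightarrow> x = 0"
    using x by (simp add: norm2_def ip_self_eq_0_iff)
  then show "nrm max_l2 x = 0 \<longleftrightarrow> x = 0"
    using nonneg le ge norm2_nonneg[OF x] by auto
  have "(c *\<^sub>R x) 0 = c * x 0"
    by (simp add: scaleR_fun_def)
  then show "nrm max_l2 (c *\<^sub>R x) = \<bar>c\<bar> * nrm max_l2 x"
    using x by (simp add: nrm_max_l2 tail_scaleR norm2_scaleR tail_l2_iff
        abs_mult max_mult_distrib_left)
  assume y: "y \<in> pts l2"
  have "norm2 (tail (x + y)) \<le> norm2 (tail x) + norm2 (tail y)"
    using x y by (simp add: tail_add norm2_triangle tail_l2_iff)
  then show "nrm max_l2 (x + y) \<le> nrm max_l2 x + nrm max_l2 y"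
    unfolding nrm_max_l2 using abs_triangle_ineq[of "x 0" "y 0"] by (simp add: max_def)
qed auto

section \<open>The weak maximizing property\<close>

text \<open>The square of a maximum is one of the two squares. Each expands into squares of the same
  piece of \<open>x\<close> and of \<open>y\<close>, which the full norms dominate, plus a cross
  term. Both cross terms vanish in the limit when \<open>y\<close> runs through a bounded
  coordinatewise null sequence.\<close>

lemma nrm_max_l2_add_power2_le:
  assumes x: "x \<in> pts l2" and y: "y \<in> pts l2"
  shows "(nrm max_l2 (x + y))\<^sup>2 \<le> (nrm max_l2 x)\<^sup>2 + (nrm max_l2 y)\<^sup>2
    + 2 * \<bar>x 0 * y 0\<bar> + 2 * \<bar>ip (tail x) (tail y)\<bar>"
    (is "_ \<le> ?R")
proof -
  have sq: "(x 0)\<^sup>2 \<le> (nrm max_l2 x)\<^sup>2" "(norm2 (tail x))\<^sup>2 \<le> (nrm max_l2 x)\<^sup>2"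
    if "x \<in> pts l2" for x
  proof -
    show "(norm2 (tail x))\<^sup>2 \<le> (nrm max_l2 x)\<^sup>2"
      using that by (intro power_mono norm2_nonneg) (simp_all add: nrm_max_l2 tail_l2_iff)
    have "\<bar>x 0\<bar>\<^sup>2 \<le> (nrm max_l2 x)\<^sup>2"
      by (intro power_mono) (simp_all add: nrm_max_l2)
    then show "(x 0)\<^sup>2 \<le> (nrm max_l2 x)\<^sup>2"
      by simp
  qed
  have "((x + y) 0)\<^sup>2 = (x 0)\<^sup>2 + (y 0)\<^sup>2 + 2 * (x 0 * y 0)"
    by (simp add: power2_sum)
  then have 1: "((x + y) 0)\<^sup>2 \<le> ?R"
    using sq(1)[OF x] sq(1)[OF y] abs_ge_self[of "x 0 * y 0"]
      abs_ge_zero[of "ip (tail x) (tail y)"] by linarith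
  have "(norm2 (tail (x + y)))\<^sup>2
      = (norm2 (tail x))\<^sup>2 + (norm2 (tail y))\<^sup>2 + 2 * ip (tail x) (tail y)"
    using x y by (simp add: tail_add norm2_power2 tail_l2_iff add_l2 ip_add_self)
  then have 2: "(norm2 (tail (x + y)))\<^sup>2 \<le> ?R"
    using sq(2)[OF x] sq(2)[OF y] abs_ge_self[of "ip (tail x) (tail y)"]
      abs_ge_zero[of "x 0 * y 0"] by linarith
  have "(nrm max_l2 (x + y))\<^sup>2 = ((x + y) 0)\<^sup>2 \<or>
      (nrm max_l2 (x + y))\<^sup>2 = (norm2 (tail (x + y)))\<^sup>2"
    unfolding nrm_max_l2 max_def by (auto simp: power2_abs)
  with 1 2 show ?thesis by metis
qed

lemma weak_maximizing_property_l2_max_l2: "weak_maximizing_property l2 max_l2"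
  unfolding weak_maximizing_property_def
proof (intro allI impI, elim exE conjE)
  fix T s
  assume T: "bounded_operator l2 max_l2 T"
    and s: "maximizing_sequence l2 max_l2 T s" and nwn: "\<not> weakly_null l2 s"
  define M where "M = operator_norm l2 max_l2 T"
  have bound: "nrm max_l2 (T x) \<le> M * norm2 x" if "x \<in> pts l2" for x
    using operator_norm_bound[OF banach_l2 banach_max_l2 T that] by (simp add: M_def)
  have T_l2: "T x \<in> pts l2" if "x \<in> pts l2" for x
    using T that by (simp add: bounded_operator_def)
  have s_l2: "s n \<in> pts l2" and s_norm: "norm2 (s n) = 1" for n
    using s by (auto simp: maximizing_sequence_def unit_sphere_def)
  obtain f where f: "bounded_operator l2 scalars f" "\<not> (\<lambda>n. f (s n)) \<longlonglongrightarrow> 0"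
    using nwn by (auto simp: weakly_null_def)
  \<comment> \<open>Nonconvergence gives a fixed gap \<open>e\<close> attained infinitely often;
    enumerating these indices by \<open>r\<close> keeps every further subsequence away from 0 under
    \<open>f\<close>.\<close>
  then obtain e where e: "e > 0" "\<And>N. \<exists>n\<ge>N. e \<le> \<bar>f (s n)\<bar>"
    unfolding LIMSEQ_iff by (auto simp: not_less)
  then have "infinite {n. e \<le> \<bar>f (s n)\<bar>}"
    by (simp add: infinite_nat_iff_unbounded_le)
  then obtain r :: "nat \<Rightarrow> nat" where r: "strict_mono r" "\<And>n. e \<le> \<bar>f (s (r n))\<bar>"
    using infinite_enumerate[of "{n. e \<le> \<bar>f (s n)\<bar>}"] by auto
  obtain q x where q: "strict_mono q" and x: "x \<in> pts l2"
    and lim: "\<And>k. (\<lambda>n. s (r (q n)) k) \<longlonglongrightarrow> x k"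
    using l2_bounded_subsequence[of "\<lambda>n. s (r n)" 1] s_l2 s_norm by auto
  define t where "t n = s (r (q n))" for n
  define w where "w n = t n - x" for n
  have t_l2: "t n \<in> pts l2" and t_norm: "norm2 (t n) = 1" for n
    by (simp_all add: t_def s_l2 s_norm)
  have w_l2: "w n \<in> pts l2" for n
    by (simp add: w_def diff_l2 t_l2 x)
  have w_bound: "norm2 (w n) \<le> 1 + norm2 x" for n
    using norm2_diff_le[OF t_l2 x] by (simp add: w_def t_norm)
  have w_lim: "(\<lambda>n. w n k) \<longlonglongrightarrow> 0" for k
    using tendsto_diff[OF lim[of k] tendsto_const[of "x k"]] by (simp add: w_def t_def)
  \<comment> \<open>This is where non-weak nullity is used: a zero limit would force
    \<open>f (t n)\<close> to 0, against the gap \<open>e\<close>.\<close>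
  have "x \<noteq> 0"
  proof
    assume "x = 0"
    then have "(\<lambda>n. t n k) \<longlonglongrightarrow> 0" for k
      using lim[of k] by (simp add: t_def)
    then have "(\<lambda>n. f (t n)) \<longlonglongrightarrow> 0"
      using t_norm by (intro functional_tendsto_0[OF f(1) t_l2, where B = 1]) simp_all
    then obtain n where "\<bar>f (t n)\<bar> < e"
      using LIMSEQ_D[OF _ e(1), of "\<lambda>n. f (t n)" 0] by auto
    with r(2)[of "q n"] show False
      by (simp add: t_def)
  qed
  then have x_pos: "norm2 x > 0"
    using ip_self_eq_0_iff[OF x] ip_self_nonneg[OF x] by (simp add: norm2_def)
  have nrm_nonneg: "0 \<le> nrm max_l2 y" for y
    by (simp add: nrm_max_l2 le_max_iff_disj)
  have "0 \<le> M * norm2 x"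
    using bound[OF x] nrm_nonneg order_trans by blast
  then have M: "0 \<le> M"
    using x_pos by (simp add: zero_le_mult_iff)
  \<comment> \<open>Weak continuity of \<open>T\<close>, coordinate by coordinate: each coordinate
    of \<open>T\<close> is a bounded functional on \<open>l2\<close>.\<close>
  have Tw_lim: "(\<lambda>n. T (w n) k) \<longlonglongrightarrow> 0" for k
  proof (rule functional_tendsto_0[where f = "\<lambda>x. T x k", OF _ w_l2 w_bound w_lim])
    have "\<bar>T x k\<bar> \<le> M * norm2 x" if "x \<in> pts l2" for x
      using abs_nth_le_nrm_max_l2[OF T_l2[OF that], of k] bound[OF that] by linarith
    then show "bounded_operator l2 scalars (\<lambda>x. T x k)"
      using T unfolding bounded_operator_def scalars_def
      by (auto simp: scaleR_fun_def)
  qed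
  have "norm2 (tail (T (w n))) \<le> M * (1 + norm2 x)" for n
  proof -
    have "norm2 (tail (T (w n))) \<le> nrm max_l2 (T (w n))"
      by (simp add: nrm_max_l2)
    also have "\<dots> \<le> M * norm2 (w n)"
      by (rule bound[OF w_l2])
    also have "\<dots> \<le> M * (1 + norm2 x)"
      by (rule mult_left_mono[OF w_bound M])
    finally show ?thesis .
  qed
  then have ip_lim: "(\<lambda>n. ip (tail (T x)) (tail (T (w n)))) \<longlonglongrightarrow> 0"
    using Tw_lim
    by (intro ip_tendsto_0) (auto simp: tail_l2_iff T_l2 x w_l2, simp add: tail_def)
  \<comment> \<open>Expand the unit norm of \<open>t n = x + w n\<close>; the mixed term tends to 0,
    so the weakly null part asymptotically carries the mass \<open>1 - ip x x\<close>.\<close>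
  have w_ip: "ip (w n) (w n) = 1 - ip x x - 2 * ip x (w n)" for n
  proof -
    have "1 = ip (x + w n) (x + w n)"
      using norm2_power2[OF t_l2, of n] by (simp add: w_def t_norm)
    then show ?thesis
      by (simp add: ip_add_self x w_l2)
  qed
  have step: "(nrm max_l2 (T (t n)))\<^sup>2 \<le> (nrm max_l2 (T x))\<^sup>2 +
      M\<^sup>2 * (1 - ip x x - 2 * ip x (w n)) +
      2 * \<bar>T x 0 * T (w n) 0\<bar> + 2 * \<bar>ip (tail (T x)) (tail (T (w n)))\<bar>" for n
  proof -
    have "T (t n) = T x + T (w n)"
      using bounded_operator_diff[OF T subspace_l2 t_l2 x, of n] by (simp add: w_def)
    moreover have "(nrm max_l2 (T (w n)))\<^sup>2 \<le> (M * norm2 (w n))\<^sup>2"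
      by (intro power_mono bound w_l2 nrm_nonneg)
    then have "(nrm max_l2 (T (w n)))\<^sup>2 \<le> M\<^sup>2 * (1 - ip x x - 2 * ip x (w n))"
      by (simp add: power_mult_distrib norm2_power2 w_l2 w_ip)
    ultimately show ?thesis
      using nrm_max_l2_add_power2_le[OF T_l2[OF x] T_l2[OF w_l2], of n] by simp
  qed
  have "(\<lambda>n. nrm max_l2 (T (s n))) \<longlonglongrightarrow> M"
    using s by (simp add: maximizing_sequence_def M_def)
  then have "(\<lambda>n. nrm max_l2 (T (t n))) \<longlonglongrightarrow> M"
    using LIMSEQ_subseq_LIMSEQ[OF _ strict_mono_o[OF r(1) q]] by (fastforce simp: o_def t_def)
  then have lhs: "(\<lambda>n. (nrm max_l2 (T (t n)))\<^sup>2) \<longlonglongrightarrow> M\<^sup>2"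
    by (intro tendsto_intros)
  have "(\<lambda>n. (nrm max_l2 (T x))\<^sup>2 +
      M\<^sup>2 * (1 - ip x x - 2 * ip x (w n)) +
      2 * \<bar>T x 0 * T (w n) 0\<bar> + 2 * \<bar>ip (tail (T x)) (tail (T (w n)))\<bar>) \<longlonglongrightarrow>
    (nrm max_l2 (T x))\<^sup>2 + M\<^sup>2 * (1 - ip x x - 2 * 0) + 2 * \<bar>T x 0 * 0\<bar> + 2 * \<bar>0\<bar>"
    by (intro tendsto_intros Tw_lim ip_lim ip_tendsto_0[OF x w_l2 w_bound w_lim])
  then have "M\<^sup>2 \<le> (nrm max_l2 (T x))\<^sup>2 + M\<^sup>2 * (1 - ip x x - 2 * 0) + 2 * \<bar>T x 0 * 0\<bar> + 2 * \<bar>0\<bar>"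
    using step by (intro LIMSEQ_le[OF lhs]) auto
  \<comment> \<open>The term \<open>M\<^sup>2\<close> cancels from both sides. Since
    \<open>bound\<close> gives the opposite inequality, \<open>T\<close> stretches \<open>x\<close>
    by exactly \<open>M\<close>.\<close>
  then have "(M * norm2 x)\<^sup>2 \<le> (nrm max_l2 (T x))\<^sup>2"
    by (simp add: power_mult_distrib norm2_power2[OF x] algebra_simps)
  then have "M * norm2 x \<le> nrm max_l2 (T x)"
    using nrm_nonneg by (rule power2_le_imp_le)
  with bound[OF x] have eq: "nrm max_l2 (T x) = M * norm2 x"
    by simp
  have "T (inverse (norm2 x) *\<^sub>R x) = inverse (norm2 x) *\<^sub>R T x"
    using T x by (simp add: bounded_operator_def)
  moreover have "nrm max_l2 (inverse (norm2 x) *\<^sub>R T x) = inverse (norm2 x) * nrm max_l2 (T x)"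
    using banach_max_l2 T_l2[OF x] x_pos by (simp add: banach_space_def)
  ultimately have "nrm max_l2 (T (inverse (norm2 x) *\<^sub>R x)) = M"
    using x_pos by (simp add: eq)
  moreover have "inverse (norm2 x) *\<^sub>R x \<in> unit_sphere l2"
    using x x_pos by (simp add: unit_sphere_def scaleR_l2 norm2_scaleR)
  ultimately show "attains_norm l2 max_l2 T"
    unfolding attains_norm_def M_def by blast
qed

section \<open>Failure of the weak minimizing property\<close>

definition expand :: "(nat \<Rightarrow> real) \<Rightarrow> nat \<Rightarrow> real" where
  "expand x = (\<lambda>k. (1 + 1 / real k) * x k)" \<comment> \<open>fixes \<open>x 0\<close>, as \<open>1 / 0 = 0\<close>\<close>

lemma expand_l2:
  assumes x: "x \<in> pts l2"
  shows "expand x \<in> pts l2" "norm2 (expand x) \<le> 2 * norm2 x"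
proof -
  have "expand x k * expand x k \<le> 4 * (x k * x k)" for k
  proof -
    \<comment> \<open>At \<open>k = 0\<close> the quotient is 0 by convention, so all factors of
      \<open>expand\<close> lie between 1 and 2.\<close>
    have "1 / real k \<le> 1"
      by (cases k) auto
    then have "(1 + 1 / real k)\<^sup>2 \<le> 2\<^sup>2"
      by (intro power_mono) auto
    then have "(1 + 1 / real k)\<^sup>2 * (x k)\<^sup>2 \<le> 4 * (x k)\<^sup>2"
      by (intro mult_right_mono) auto
    then show ?thesis
      by (simp add: expand_def power2_eq_square mult_ac)
  qed
  then have "(\<Sum>k<N. expand x k * expand x k) \<le> 4 * (\<Sum>k<N. x k * x k)" for N
    by (simp add: sum_distrib_left sum_mono)
  also have "4 * (\<Sum>k<N. x k * x k) \<le> (2 * norm2 x)\<^sup>2" for N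
    using partial_sums_le_norm2[OF x, of N] by (simp add: power_mult_distrib)
  finally show "expand x \<in> pts l2" "norm2 (expand x) \<le> 2 * norm2 x"
    using l2_partial_sums_le[of "expand x" "2 * norm2 x"] norm2_nonneg[OF x] by auto
qed

lemma bounded_operator_expand: "bounded_operator l2 max_l2 expand"
proof -
  have "nrm max_l2 (expand x) \<le> 2 * norm2 x" if "x \<in> pts l2" for x
    using nrm_max_l2_le[OF expand_l2(1)[OF that]] expand_l2(2)[OF that] by linarith
  then show ?thesis
    unfolding bounded_operator_def
    by (auto simp: expand_l2 scaleR_fun_def) (auto simp: expand_def fun_eq_iff algebra_simps)
qed

text \<open>Every factor acting on the tail exceeds 1, so the termwise differences of squares are
  nonnegative, with a positive one wherever the tail has a nonzero entry.\<close>

lemma norm2_tail_expand_gt: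
  assumes x: "x \<in> pts l2" and nz: "norm2 (tail x) \<noteq> 0"
  shows "norm2 (tail x) < norm2 (tail (expand x))"
proof -
  define y where "y = tail x"
  define z where "z = tail (expand x)"
  have y: "y \<in> pts l2" and z: "z \<in> pts l2"
    using x by (simp_all add: y_def z_def tail_l2_iff expand_l2)
  obtain i where i: "y i \<noteq> 0"
    using nz unfolding y_def[symmetric] norm2_def ip_def by force
  have diff: "z k * z k - y k * y k = ((1 + 1 / real (Suc k))\<^sup>2 - 1) * (y k)\<^sup>2" for k
    by (simp add: y_def z_def tail_def expand_def power2_eq_square algebra_simps)
  have gt: "(1 + 1 / real (Suc k))\<^sup>2 > 1" for k
    by (intro one_less_power) auto
  have "0 < (\<Sum>k. z k * z k - y k * y k)"
  proof (rule suminf_pos2[where i = i])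
    show "summable (\<lambda>k. z k * z k - y k * y k)"
      using y z by (intro summable_diff) (auto simp: l2_iff)
    show "0 \<le> z k * z k - y k * y k" for k
      unfolding diff using gt[of k] by (intro mult_nonneg_nonneg) auto
    show "0 < z i * z i - y i * y i"
      unfolding diff using gt[of i] i by (intro mult_pos_pos) auto
  qed
  also have "\<dots> = ip z z - ip y y"
    unfolding ip_def using y z by (intro suminf_diff[symmetric]) (auto simp: l2_iff)
  finally show ?thesis
    by (simp add: norm2_def y_def z_def)
qed

text \<open>The squares of the two pieces of a unit vector add up to 1. Either the head already
  exceeds \<open>sqrt (1 / 2)\<close>, and \<open>expand\<close> keeps it, or the tail reaches that
  value, and \<open>expand\<close> strictly enlarges it. The strict inequality is what later
  excludes a minimizer.\<close>

lemma nrm_expand_gt: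
  assumes "x \<in> unit_sphere l2"
  shows "sqrt (1 / 2) < nrm max_l2 (expand x)"
proof (cases "sqrt (1 / 2) < \<bar>x 0\<bar>")
  case True
  then show ?thesis
    by (simp add: nrm_max_l2 expand_def less_max_iff_disj)
next
  case False
  have x: "x \<in> pts l2" "norm2 x = 1"
    using assms by (auto simp: unit_sphere_def)
  have "\<bar>x 0\<bar>\<^sup>2 \<le> (sqrt (1 / 2))\<^sup>2"
    using False by (intro power_mono) auto
  then have "(x 0)\<^sup>2 \<le> 1 / 2"
    by simp
  then have "1 / 2 \<le> (norm2 (tail x))\<^sup>2"
    using norm2_split_head[OF x(1)] x(2) by simp
  then have "sqrt (1 / 2) \<le> norm2 (tail x)"
    using norm2_nonneg[of "tail x"] x(1) by (intro real_le_lsqrt) (auto simp: tail_l2_iff)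
  moreover have "0 < sqrt (1 / 2 :: real)"
    by simp
  ultimately have "sqrt (1 / 2) < norm2 (tail (expand x))"
    using norm2_tail_expand_gt[OF x(1)] by linarith
  then show ?thesis
    by (simp add: nrm_max_l2 less_max_iff_disj)
qed

lemma singleton_l2:
  "(\<lambda>k. if k = n then c else 0) \<in> pts l2" "norm2 (\<lambda>k. if k = n then c else 0) = \<bar>c\<bar>"
proof -
  have "(\<lambda>k. (if k = n then c else 0) * (if k = n then c else 0)) sums (c * c)"
    using sums_single[of n "\<lambda>_. c * c"] by (simp add: if_distrib cong: if_cong)
  then show "(\<lambda>k. if k = n then c else 0) \<in> pts l2" "norm2 (\<lambda>k. if k = n then c else 0) = \<bar>c\<bar>"
    by (auto simp: l2_iff norm2_def ip_def sums_iff)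
qed

lemma not_weak_minimizing_property_l2_max_l2: "\<not> weak_minimizing_property l2 max_l2"
proof -
  define h where "h = sqrt (1 / 2 :: real)"
  have h: "h > 0" "h\<^sup>2 = 1 / 2"
    by (simp_all add: h_def)
  \<comment> \<open>Both pieces have size \<open>h\<close>, balancing the maximum, while the tail
    mass moves to coordinates whose factors approach 1. The weak limit is \<open>h\<close> times the
    first unit vector; normalized, it has an image of norm 1, well above \<open>h\<close>, so the
    argument used for maximizing sequences has no analogue.\<close>
  define s where "s n = (\<lambda>k. if k = 0 \<or> k = Suc n then h else 0)" for n
  have tail_s: "tail (s n) = (\<lambda>k. if k = n then h else 0)"
    and tail_expand: "tail (expand (s n)) = (\<lambda>k. if k = n then (1 + 1 / real (Suc n)) * h else 0)"
    for n
    by (auto simp: tail_def s_def expand_def)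
  have s_l2: "s n \<in> pts l2" for n
    by (simp add: tail_l2_iff[of "s n", symmetric] tail_s singleton_l2)
  have "(norm2 (s n))\<^sup>2 = 1" for n
    by (simp add: norm2_split_head[OF s_l2] tail_s singleton_l2 h) (simp add: s_def h)
  then have s_norm: "norm2 (s n) = 1" for n
    using norm2_nonneg[OF s_l2, of n] power2_eq_iff_nonneg[of "norm2 (s n)" 1] by simp
  have s_sphere: "s n \<in> unit_sphere l2" for n
    by (simp add: unit_sphere_def s_l2 s_norm)
  have nrm_s: "nrm max_l2 (expand (s n)) = (1 + 1 / real (Suc n)) * h" for n
  proof -
    have "expand (s n) 0 = h"
      by (simp add: expand_def s_def)
    moreover have "h \<le> (1 + 1 / real (Suc n)) * h" "0 \<le> (1 + 1 / real (Suc n)) * h"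
      using h(1) by (simp_all add: field_simps)
    ultimately show ?thesis
      using h(1) unfolding nrm_max_l2 tail_expand singleton_l2 by linarith
  qed
  have "(\<lambda>n. (1 + 1 / real (Suc n)) * h) \<longlonglongrightarrow> (1 + 0) * h"
    using LIMSEQ_inverse_real_of_nat by (intro tendsto_intros) (simp add: inverse_eq_divide)
  then have lim: "(\<lambda>n. nrm max_l2 (expand (s n))) \<longlonglongrightarrow> h"
    by (simp add: nrm_s)
  have gt: "h < nrm max_l2 (expand x)" if "x \<in> unit_sphere l2" for x
    using nrm_expand_gt[OF that] by (simp add: h_def)
  \<comment> \<open>The values along \<open>s\<close> tend to \<open>h\<close> and bound the infimum
    from above; \<open>gt\<close> bounds it from below.\<close>
  have min: "min_modulus l2 max_l2 expand = h"
  proof (rule antisym)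
    have "min_modulus l2 max_l2 expand \<le> nrm max_l2 (expand (s n))" for n
      unfolding min_modulus_def
      using gt less_imp_le by (intro cINF_lower bdd_belowI2[where m = h] s_sphere) blast
    then show "min_modulus l2 max_l2 expand \<le> h"
      by (intro LIMSEQ_le_const[OF lim]) blast
    show "h \<le> min_modulus l2 max_l2 expand"
      unfolding min_modulus_def using s_sphere gt less_imp_le
      by (intro cINF_greatest) blast+
  qed
  have "minimizing_sequence l2 max_l2 expand s"
    by (simp add: minimizing_sequence_def s_sphere min lim)
  moreover have "\<not> weakly_null l2 s"
  proof
    assume "weakly_null l2 s"
    \<comment> \<open>Evaluation at coordinate 0 is constantly \<open>h\<close> along
      \<open>s\<close>, so it detects that the sequence is not weakly null.\<close>
    moreover have "bounded_operator l2 scalars (\<lambda>x. x 0)"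
      unfolding bounded_operator_def scalars_def
      by (auto simp: scaleR_fun_def intro!: exI[of _ 1] abs_nth_le_norm2)
    ultimately have "(\<lambda>n. s n 0) \<longlonglongrightarrow> 0"
      unfolding weakly_null_def by blast
    then show False
      using h(1) by (simp add: s_def LIMSEQ_const_iff)
  qed
  moreover have "\<not> attains_min_modulus l2 max_l2 expand"
    using gt by (auto simp: attains_min_modulus_def min)
  ultimately show ?thesis
    using bounded_operator_expand unfolding weak_minimizing_property_def by blast
qed

theorem mainTheorem6:
  shows "\<exists>(X :: (nat \<Rightarrow> real) normed_space) (Y :: (nat \<Rightarrow> real) normed_space).
           banach_space X \<and> banach_space Y \<and>
           weak_maximizing_property X Y \<and> \<not> weak_minimizing_property X Y"
  using banach_l2 banach_max_l2 weak_maximizing_property_l2_max_l2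
    not_weak_minimizing_property_l2_max_l2 by blast

end
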